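(* For every integer $n\ge 0$ and every $j\in\{0,1,2,3\}$, \[ \nu_2\bigl(t_5(4n+j)\bigr)=4\left\lceil\frac{\nu_2(n+1)}{2}\right\rceil-\bigl(\nu_2(n+1)\bmod 2\bigr). \] In particular, $t_5(n)\neq 0$ for all $n\ge 0$.
   Context: Let $T(x)=\prod_{k=0}^{\infty}(1-x^{2^k})$, a formal power series with integer coefficients (the generating function of the Thue--Morse sequence $t(0)=1$, $t(2n)=t(n)$, $t(2n+1)=-t(n)$). For an integer $m\ge 1$ define the integers $t_m(n)$, $n\ge 0$, by $T(x)^m=\sum_{n\ge 0}t_m(n)x^n$. Here $\nu_2$ denotes the $2$-adic valuation on integers (with $\nu_2(0)=\infty$), and $a\bmod 2\in\{0,1\}$ denotes the remainder of $a$ upon division by $2$. *)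

theory Defs
  imports
    "HOL-Analysis.Infinite_Products"
    "HOL-Computational_Algebra.Computational_Algebra"
    "HOL-Library.Extended_Nat"
begin

text \<open>
  The infinite product is taken in the coefficientwise (X-adic) topology that the library puts on
  formal power series; the lemma \<open>TM_has_prod\<close> below shows that it converges.
\<close>

definition TM :: "int fps" where
  "TM = (\<Prod>k. 1 - fps_X ^ (2 ^ k))"

definition tm :: "nat \<Rightarrow> nat \<Rightarrow> int" where
  "tm m n = fps_nth (TM ^ m) n"

text \<open>
  The library function \<open>multiplicity\<close> returns 0 at 0, so the convention that the valuation of 0
  is infinite is made explicit here.
\<close>

definition nu2 :: "int \<Rightarrow> enat" where
  "nu2 a = (if a = 0 then \<infinity> else enat (multiplicity 2 a))"

lemma TM_has_prod: "(\<lambda>k. 1 - fps_X ^ (2 ^ k) :: int fps) has_prod TM"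
proof -
  let ?f = "\<lambda>k. 1 - fps_X ^ (2 ^ k) :: int fps"
  let ?P = "\<lambda>N. \<Prod>i\<le>N. ?f i"
  have partial_step: "fps_nth (?P (Suc N)) n = fps_nth (?P N) n" if "n \<le> N" for n N
  proof -
    have "n < 2 ^ Suc N"
      using that less_exp[of "Suc N"] by linarith
    then have "fps_nth (?P N * fps_X ^ (2 ^ Suc N)) n = 0"
      by (subst fps_X_power_mult_right_nth) simp
    moreover have "?P (Suc N) = ?P N - ?P N * fps_X ^ (2 ^ Suc N)"
      by (simp add: algebra_simps)
    ultimately show ?thesis
      by (metis diff_zero fps_sub_nth)
  qed
  have stable: "fps_nth (?P N) n = fps_nth (?P n) n" if "n \<le> N" for n N
    using that
  proof (induction N rule: dec_induct)
    case base
    show ?case by simp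
  next
    case (step N)
    show ?case
      by (rule trans[OF partial_step[OF step.hyps(1)] step.IH])
  qed
  define L where "L = Abs_fps (\<lambda>n. fps_nth (?P n) n)"
  have "?P \<longlonglongrightarrow> L"
  proof (rule tendsto_fpsI)
    fix n
    show "\<forall>\<^sub>F N in sequentially. fps_nth (?P N) n = fps_nth L n"
      using eventually_ge_at_top[of n]
      by eventually_elim (unfold L_def fps_nth_Abs_fps, rule stable)
  qed
  moreover have "fps_nth L 0 = 1"
    by (simp add: L_def)
  then have "L \<noteq> 0"
    by auto
  ultimately have "?f has_prod L"
    by (simp add: has_prod_def raw_has_prod_def)
  then show ?thesis
    unfolding TM_def using has_prod_unique by metis
qed

end

theory Submission
  imports Defs
begin

text \<open>
  Extend \<open>t\<^sub>5\<close> by zero to the integers. The functional equation \<open>T(x) = (1 - x) T(x\<^sup>2)\<close>, applied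
  twice, says that a block of four consecutive values ending at \<open>4n + 3\<close> is the image, under a
  fixed \<open>4 \<times> 4\<close> integer matrix, of the window of four values ending at \<open>n\<close>. This matrix is
  diagonalisable with eigenvalues 16, 16, 64, 64; the linear forms \<open>P\<close>, \<open>R\<close> and \<open>Q\<close>, \<open>S\<close> below
  are its left eigenvectors. If \<open>e\<close> denotes the claimed valuation, then on the block ending at
  \<open>4n + 3\<close> the form \<open>R\<close> has valuation exactly \<open>e + 4\<close>, whereas the other three forms are divisible
  by a power of two high enough for \<open>R\<close> to determine the valuation of every entry. Passing from
  \<open>n\<close> to \<open>4n + 3\<close> multiplies everything by (at least) 16, so \<open>e\<close> grows by 4, and the cases
  of even \<open>n\<close> and of \<open>n \<equiv> 1 (mod 4)\<close> can be settled by congruences.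
\<close>

section \<open>The recurrence\<close>

text \<open>Substituting \<open>fps_X ^ 2\<close> turns the factor with index k into the one with
  index k + 1, so both sides are limits of the same shifted partial products.\<close>

lemma TM_functional_equation: "TM = (1 - fps_X) * (TM oo fps_X ^ 2)"
proof (rule LIMSEQ_unique)
  let ?p = "\<lambda>N. \<Prod>k<N. 1 - fps_X ^ (2 ^ k) :: int fps"
  have lim: "?p \<longlonglongrightarrow> TM"
    by (rule has_prod_imp_tendsto'[OF TM_has_prod])
  then show "(\<lambda>N. ?p (Suc N)) \<longlonglongrightarrow> TM"
    by (rule LIMSEQ_Suc)
  have step: "?p (Suc N) = (1 - fps_X) * (?p N oo fps_X ^ 2)" for N
    by (simp add: prod.lessThan_Suc_shift fps_compose_prod_distrib fps_compose_sub_distrib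
        fps_X_power_compose flip: power_mult del: prod.lessThan_Suc)
  show "(\<lambda>N. ?p (Suc N)) \<longlonglongrightarrow> (1 - fps_X) * (TM oo fps_X ^ 2)"
    unfolding step
  proof (rule tendsto_fpsI)
    fix n
    \<comment> \<open>Coefficient n of the right-hand side involves only coefficients of
      \<open>?p N\<close> up to n, and these finitely many are all eventually constant.\<close>
    have "\<forall>\<^sub>F N in sequentially. \<forall>m\<in>{..n}. fps_nth (?p N) m = fps_nth TM m"
      using lim by (subst eventually_ball_finite_distrib) (auto simp: tendsto_fps_iff)
    then show "\<forall>\<^sub>F N in sequentially. fps_nth ((1 - fps_X) * (?p N oo fps_X ^ 2)) n =
        fps_nth ((1 - fps_X) * (TM oo fps_X ^ 2)) n"
      by eventually_elim (simp add: algebra_simps fps_nth_compose_X_power)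
  qed
qed

definition t5 :: "int \<Rightarrow> int" where
  "t5 k = (if k < 0 then 0 else tm 5 (nat k))"

lemma t5_of_nat [simp]: "t5 (int n) = tm 5 n"
  by (simp add: t5_def)

text \<open>The coefficients of \<open>TM ^ 5 oo fps_X ^ 2\<close>, extended by zero to negative
  indices.\<close>

definition spread :: "int \<Rightarrow> int" where
  "spread k = (if even k then t5 (k div 2) else 0)"

text \<open>Coefficient comparison in the fifth power of the functional equation; the numbers are
  the coefficients of (1 - x)^5. The extension by zero removes boundary cases for small
  indices.\<close>

lemma t5_conv_spread:
  "t5 k = spread k - 5 * spread (k - 1) + 10 * spread (k - 2) - 10 * spread (k - 3)
    + 5 * spread (k - 4) - spread (k - 5)"
proof (cases "k < 0")
  case True
  have "spread i = 0" if "i < 0" for i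
    using that by (simp add: spread_def t5_def pos_imp_zdiv_neg_iff)
  with True show ?thesis by (simp add: t5_def)
next
  case False
  then obtain n where n: "k = int n"
    using nonneg_int_cases[of k] by (auto simp: not_less)
  define G where "G = TM ^ 5 oo fps_X ^ 2"
  have G: "(if n < i then 0 else fps_nth G (n - i)) = spread (int n - int i)" for i
  proof (cases "n < i")
    case True
    then show ?thesis by (simp add: spread_def t5_def)
  next
    case False
    then have "spread (int n - int i) = spread (int (n - i))"
      by (simp add: of_nat_diff)
    also have "\<dots> = fps_nth G (n - i)"
      by (auto simp: spread_def G_def fps_nth_compose_X_power tm_def t5_def nat_div_distrib
          simp del: of_nat_diff)
    finally show ?thesis using False by simp
  qed
  have "TM ^ 5 = (1 - fps_X) ^ 5 * G"
    unfolding G_def by (subst TM_functional_equation)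
      (simp add: power_mult_distrib fps_compose_power)
  also have "(1 - fps_X :: int fps) ^ 5 = fps_X ^ 0 - fps_const 5 * fps_X ^ 1 + fps_const 10 * fps_X ^ 2
      - fps_const 10 * fps_X ^ 3 + fps_const 5 * fps_X ^ 4 - fps_X ^ 5"
    by (simp add: eval_nat_numeral algebra_simps flip: numeral_fps_const)
  finally have "TM ^ 5 = fps_X ^ 0 * G - fps_const 5 * (fps_X ^ 1 * G)
      + fps_const 10 * (fps_X ^ 2 * G) - fps_const 10 * (fps_X ^ 3 * G)
      + fps_const 5 * (fps_X ^ 4 * G) - fps_X ^ 5 * G"
    by (simp only: ring_distribs mult.assoc)
  then have "fps_nth (TM ^ 5) n = spread (int n - int 0) - 5 * spread (int n - int 1)
      + 10 * spread (int n - int 2) - 10 * spread (int n - int 3)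
      + 5 * spread (int n - int 4) - spread (int n - int 5)"
    by (simp only: fps_add_nth fps_sub_nth fps_mult_left_const_nth fps_X_power_mult_nth G)
  then show ?thesis
    by (simp add: tm_def n)
qed

lemma spread_double: "spread (2 * k) = t5 k" "spread (2 * k + 1) = 0"
  by (simp_all add: spread_def)

lemma t5_even: "t5 (2 * k) = t5 k + 10 * t5 (k - 1) + 5 * t5 (k - 2)"
  using t5_conv_spread[of "2 * k"] spread_double[of k] spread_double[of "k - 1"]
    spread_double[of "k - 2"] spread_double(2)[of "k - 3"]
  by (simp add: algebra_simps)

lemma t5_odd: "t5 (2 * k + 1) = - 5 * t5 k - 10 * t5 (k - 1) - t5 (k - 2)"
  using t5_conv_spread[of "2 * k + 1"] spread_double[of k] spread_double[of "k - 1"]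
    spread_double[of "k - 2"]
  by (simp add: algebra_simps)

lemma t5_block:
  "t5 (4 * n) = t5 n - 35 * t5 (n - 1) - 45 * t5 (n - 2) + 15 * t5 (n - 3)"
  "t5 (4 * n + 1) = - 5 * t5 n - t5 (n - 1) + 65 * t5 (n - 2) + 5 * t5 (n - 3)"
  "t5 (4 * n + 2) = 5 * t5 n + 65 * t5 (n - 1) - t5 (n - 2) - 5 * t5 (n - 3)"
  "t5 (4 * n + 3) = 15 * t5 n - 45 * t5 (n - 1) - 35 * t5 (n - 2) + t5 (n - 3)"
proof -
  have e: "t5 (2 * n) = t5 n + 10 * t5 (n - 1) + 5 * t5 (n - 2)"
    "t5 (2 * n - 2) = t5 (n - 1) + 10 * t5 (n - 2) + 5 * t5 (n - 3)"
    using t5_even[of n] t5_even[of "n - 1"] by (simp_all add: algebra_simps)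
  have o: "t5 (2 * n + 1) = - 5 * t5 n - 10 * t5 (n - 1) - t5 (n - 2)"
    "t5 (2 * n - 1) = - 5 * t5 (n - 1) - 10 * t5 (n - 2) - t5 (n - 3)"
    using t5_odd[of n] t5_odd[of "n - 1"] by (simp_all add: algebra_simps)
  show "t5 (4 * n) = t5 n - 35 * t5 (n - 1) - 45 * t5 (n - 2) + 15 * t5 (n - 3)"
    using t5_even[of "2 * n"] e o by simp
  show "t5 (4 * n + 1) = - 5 * t5 n - t5 (n - 1) + 65 * t5 (n - 2) + 5 * t5 (n - 3)"
    using t5_odd[of "2 * n"] e o by simp
  show "t5 (4 * n + 2) = 5 * t5 n + 65 * t5 (n - 1) - t5 (n - 2) - 5 * t5 (n - 3)"
    using t5_even[of "2 * n + 1"] e o by (simp add: algebra_simps)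
  show "t5 (4 * n + 3) = 15 * t5 n - 45 * t5 (n - 1) - 35 * t5 (n - 2) + t5 (n - 3)"
    using t5_odd[of "2 * n + 1"] e o by (simp add: algebra_simps)
qed

section \<open>Eigenforms\<close>

text \<open>The block matrix commutes with reversing the window. Hence the eigenforms split into
  \<open>P\<close>, \<open>Q\<close>, built from sums of mirror-image entries, and \<open>R\<close>,
  \<open>S\<close>, built from their differences.\<close>

definition P :: "int \<Rightarrow> int" where
  "P k = 3 * (t5 (k - 3) + t5 k) + 5 * (t5 (k - 2) + t5 (k - 1))"

definition Q :: "int \<Rightarrow> int" where
  "Q k = t5 (k - 2) + t5 (k - 1)"

definition R :: "int \<Rightarrow> int" where
  "R k = 5 * (t5 (k - 3) - t5 k) + (t5 (k - 2) - t5 (k - 1))"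

definition S :: "int \<Rightarrow> int" where
  "S k = (t5 (k - 3) - t5 k) + 5 * (t5 (k - 2) - t5 (k - 1))"

lemma eigenforms:
  "P (4 * n + 3) = 16 * P n" "Q (4 * n + 3) = 64 * Q n"
  "R (4 * n + 3) = 16 * R n" "S (4 * n + 3) = 64 * S n"
  using t5_block[of n] by (simp_all add: P_def Q_def R_def S_def add.commute)

text \<open>Each symmetry type is inverted separately up to a factor 24; recovering entries from
  sums and differences costs another factor 2.\<close>

lemma block_from_eigenforms:
  "48 * t5 (4 * n) = 8 * P (4 * n + 3) - 40 * Q (4 * n + 3) + 5 * R (4 * n + 3) - S (4 * n + 3)"
  "48 * t5 (4 * n + 1) = 24 * Q (4 * n + 3) + 5 * S (4 * n + 3) - R (4 * n + 3)"
  "48 * t5 (4 * n + 2) = 24 * Q (4 * n + 3) - 5 * S (4 * n + 3) + R (4 * n + 3)"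
  "48 * t5 (4 * n + 3) = 8 * P (4 * n + 3) - 40 * Q (4 * n + 3) - 5 * R (4 * n + 3) + S (4 * n + 3)"
  by (simp_all add: P_def Q_def R_def S_def add.commute)

text \<open>The powers fit the inversion formulas: after multiplication by 8, 40 or 24 for
  \<open>P\<close>, \<open>Q\<close> and by 1 or 5 for \<open>S\<close>, these forms contribute even
  multiples of 16 * 2^e, while \<open>R\<close> contributes an odd one.\<close>

definition block_invariant :: "int \<Rightarrow> nat \<Rightarrow> bool" where
  "block_invariant n e \<longleftrightarrow> (\<exists>p q r s. odd r \<and> P (4 * n + 3) = 4 * 2 ^ e * p \<and>
     Q (4 * n + 3) = 4 * 2 ^ e * q \<and> R (4 * n + 3) = 16 * 2 ^ e * r \<and>
     S (4 * n + 3) = 32 * 2 ^ e * s)"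

text \<open>Absorbs the 48 = 16 * 3 of the inversion formulas: 3 is coprime to 2^e, so it divides
  \<open>z\<close>, and the quotient stays odd.\<close>

lemma odd_part_of_triple:
  fixes u z :: int
  assumes "48 * u = 16 * (2 ^ e * z)" "odd z"
  shows "\<exists>y. odd y \<and> u = 2 ^ e * y"
proof -
  have u: "3 * u = 2 ^ e * z"
    using assms(1) by simp
  have "coprime (3 :: int) (2 ^ e)"
    by simp
  then have "3 dvd z"
    using u by (metis coprime_dvd_mult_right_iff dvd_triv_left)
  then obtain y where "z = 3 * y" ..
  then show ?thesis
    using u assms(2) by (intro exI[of _ y]) auto
qed

lemma block_invariant_imp_odd_part:
  assumes "block_invariant n e" "i \<in> {0, 1, 2, 3}"
  shows "\<exists>y. odd y \<and> t5 (4 * n + i) = 2 ^ e * y"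
proof -
  from assms(1) obtain p q r s where r: "odd r"
    and eq: "P (4 * n + 3) = 4 * 2 ^ e * p" "Q (4 * n + 3) = 4 * 2 ^ e * q"
      "R (4 * n + 3) = 16 * 2 ^ e * r" "S (4 * n + 3) = 32 * 2 ^ e * s"
    unfolding block_invariant_def by blast
  have "48 * t5 (4 * n) = 16 * (2 ^ e * (2 * p - 10 * q + 5 * r - 2 * s))"
    "48 * t5 (4 * n + 1) = 16 * (2 ^ e * (6 * q + 10 * s - r))"
    "48 * t5 (4 * n + 2) = 16 * (2 ^ e * (6 * q - 10 * s + r))"
    "48 * t5 (4 * n + 3) = 16 * (2 ^ e * (2 * p - 10 * q - 5 * r + 2 * s))"
    unfolding block_from_eigenforms eq by (simp_all add: algebra_simps)
  note this[THEN odd_part_of_triple]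
  then show ?thesis
    using assms(2) r by auto
qed

lemma block_invariant_step:
  assumes "block_invariant n e"
  shows "block_invariant (4 * n + 3) (e + 4)"
proof -
  from assms obtain p q r s where "odd r"
    and "P (4 * n + 3) = 4 * 2 ^ e * p" "Q (4 * n + 3) = 4 * 2 ^ e * q"
      "R (4 * n + 3) = 16 * 2 ^ e * r" "S (4 * n + 3) = 32 * 2 ^ e * s"
    unfolding block_invariant_def by blast
  then show ?thesis
    unfolding block_invariant_def eigenforms(1-4)[of "4 * n + 3"]
    \<comment> \<open>The eigenvalue 16 is exactly the growth of 2^e; the eigenvalue 64 leaves a
      spare factor 4.\<close>
    by (intro exI[of _ p] exI[of _ "4 * q"] exI[of _ r] exI[of _ "4 * s"])
      (simp add: power_add)
qed

section \<open>Base cases\<close>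

lemma parity_R_P: "even (R k) \<longleftrightarrow> even (P k)"
  by (simp add: P_def R_def)

text \<open>All 16 entries of the block matrix are odd, so modulo 2 every value in the block is the
  sum of the window, as is \<open>R k\<close>.\<close>

lemma t5_block_parity:
  assumes "i \<in> {0, 1, 2, 3}"
  shows "even (t5 (4 * k + i)) \<longleftrightarrow> even (R k)"
proof -
  have "even (t5 (4 * k)) \<longleftrightarrow> even (R k)" "even (t5 (4 * k + 1)) \<longleftrightarrow> even (R k)"
    "even (t5 (4 * k + 2)) \<longleftrightarrow> even (R k)" "even (t5 (4 * k + 3)) \<longleftrightarrow> even (R k)"
    unfolding t5_block by (simp add: R_def, argo)+
  then show ?thesis
    using assms by auto
qed

lemma t5_block_parities:
  "even (t5 (4 * k)) \<longleftrightarrow> even (R k)" "even (t5 (4 * k + 1)) \<longleftrightarrow> even (R k)"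
  "even (t5 (4 * k + 2)) \<longleftrightarrow> even (R k)" "even (t5 (4 * k + 3)) \<longleftrightarrow> even (R k)"
  "even (t5 (4 * k - 1)) \<longleftrightarrow> even (R (k - 1))" "even (t5 (4 * k - 2)) \<longleftrightarrow> even (R (k - 1))"
  "even (t5 (4 * k - 3)) \<longleftrightarrow> even (R (k - 1))"
  using t5_block_parity[of 0 k] t5_block_parity[of 1 k] t5_block_parity[of 2 k]
    t5_block_parity[of 3 k] t5_block_parity[of 3 "k - 1"] t5_block_parity[of 2 "k - 1"]
    t5_block_parity[of 1 "k - 1"]
  by (simp_all add: algebra_simps)

lemma tm_0: "tm m 0 = 1"
proof -
  have "fps_nth (\<Prod>k<N. 1 - fps_X ^ (2 ^ k) :: int fps) 0 = 1" for N
    by (induction N) auto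
  moreover have "\<forall>\<^sub>F N in sequentially.
      fps_nth (\<Prod>k<N. 1 - fps_X ^ (2 ^ k) :: int fps) 0 = fps_nth TM 0"
    using has_prod_imp_tendsto'[OF TM_has_prod] by (simp add: tendsto_fps_iff)
  ultimately have "fps_nth TM 0 = 1"
    by simp
  then show ?thesis
    by (simp add: tm_def fps_nth_power_0)
qed

text \<open>For k = 4m + j the window has j + 1 entries from block m and 3 - j from block m - 1. By
  induction the entries of exactly one of these blocks are odd, so the parity of \<open>R k\<close>
  is that of j + 1. The start at -1 is needed for block m - 1 when m = 0.\<close>

lemma even_R_iff: "k \<ge> -1 \<Longrightarrow> even (R k) \<longleftrightarrow> odd k"
proof (induction "nat (k + 1)" arbitrary: k rule: less_induct)
  case less
  consider "k = -1" | "k = 0" | "k > 0"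
    using less.prems by linarith
  then show ?case
  proof cases
    case 1
    then show ?thesis by (simp add: R_def t5_def)
  next
    case 2
    then show ?thesis by (simp add: R_def t5_def tm_0)
  next
    case 3
    define m where "m = k div 4"
    have IH: "even (R m) \<longleftrightarrow> odd m" "even (R (m - 1)) \<longleftrightarrow> even m"
      using less.hyps[of m] less.hyps[of "m - 1"] 3 by (auto simp: m_def)
    consider "k = 4 * m" | "k = 4 * m + 1" | "k = 4 * m + 2" | "k = 4 * m + 3"
      unfolding m_def by linarith
    then show ?thesis
      using t5_block_parities[of m] R_def[of k] IH by cases (simp_all add: add.commute)
  qed
qed

lemma block_invariant_even:
  assumes "even n" "n \<ge> 0"
  shows "block_invariant n 0"
  unfolding block_invariant_def eigenforms
  by (intro exI[of _ "4 * P n"] exI[of _ "16 * Q n"] exI[of _ "R n"] exI[of _ "2 * S n"])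
    (use assms even_R_iff[of n] in simp)

text \<open>The weights 1 and 5 cancel \<open>R\<close> in the inversion formulas. What remains is 8
  * \<open>P n\<close> modulo 16, and \<open>P n\<close> is odd.\<close>

lemma half_block_mod_16_even:
  assumes "even n" "n \<ge> 0"
  shows "(t5 (4 * n) + 5 * t5 (4 * n + 1)) mod 16 = 8"
    and "(5 * t5 (4 * n + 2) + t5 (4 * n + 3)) mod 16 = 8"
proof -
  obtain z where z: "P n = 2 * z + 1"
    using assms even_R_iff[of n] parity_R_P[of n] by (auto elim: oddE)
  have "3 * (t5 (4 * n) + 5 * t5 (4 * n + 1)) = 8 * P n + 320 * Q n + 96 * S n"
    "3 * (5 * t5 (4 * n + 2) + t5 (4 * n + 3)) = 8 * P n + 320 * Q n - 96 * S n"
    using block_from_eigenforms[of n] eigenforms[of n] by simp_all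
  then have "3 * (t5 (4 * n) + 5 * t5 (4 * n + 1)) = 16 * (z + 20 * Q n + 6 * S n) + 8"
    "3 * (5 * t5 (4 * n + 2) + t5 (4 * n + 3)) = 16 * (z + 20 * Q n - 6 * S n) + 8"
    unfolding z by (simp_all add: algebra_simps)
  moreover have "x mod 16 = 8" if "3 * x = 16 * w + 8" for x w :: int
  proof -
    \<comment> \<open>Here 11 is the inverse of 3 modulo 16.\<close>
    have "x = 8 + 16 * (11 * w + 5 - 2 * x)"
      using that by simp
    then show ?thesis
      by (metis mod_mult_self2 mod_pos_pos_trivial zero_le_numeral numeral_less_iff
          semiring_norm(76,78,81) numeral_eq_iff)
  qed
  ultimately show "(t5 (4 * n) + 5 * t5 (4 * n + 1)) mod 16 = 8"
    "(5 * t5 (4 * n + 2) + t5 (4 * n + 3)) mod 16 = 8"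
    by blast+
qed

lemma half_block_mod_16_odd:
  assumes "block_invariant n e" "e \<ge> 3"
  shows "(t5 (4 * n) + 5 * t5 (4 * n + 1)) mod 16 = 0"
    and "(5 * t5 (4 * n + 2) + t5 (4 * n + 3)) mod 16 = 0"
proof -
  have sum: "16 dvd 2 ^ e * y + 2 ^ e * z" if "odd y" "odd z" for y z :: int
  proof -
    \<comment> \<open>The fourth factor 2 comes from the sum of two odd numbers.\<close>
    have "(2 :: int) ^ 3 * 2 dvd 2 ^ e * (y + z)"
      using that assms(2) by (intro mult_dvd_mono le_imp_power_dvd) auto
    then show ?thesis
      by (simp add: distrib_left)
  qed
  obtain a b c d where "odd a" "odd b" "odd c" "odd d"
    and eq: "t5 (4 * n) = 2 ^ e * a" "t5 (4 * n + 1) = 2 ^ e * b"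
      "t5 (4 * n + 2) = 2 ^ e * c" "t5 (4 * n + 3) = 2 ^ e * d"
    using block_invariant_imp_odd_part[OF assms(1), of 0]
      block_invariant_imp_odd_part[OF assms(1), of 1]
      block_invariant_imp_odd_part[OF assms(1), of 2]
      block_invariant_imp_odd_part[OF assms(1), of 3] by auto
  then show "(t5 (4 * n) + 5 * t5 (4 * n + 1)) mod 16 = 0"
    and "(5 * t5 (4 * n + 2) + t5 (4 * n + 3)) mod 16 = 0"
    using sum[of a "5 * b"] sum[of "5 * c" d] unfolding eq
    by (simp_all add: mod_eq_0_iff_dvd mult.left_commute)
qed

text \<open>The window ending at 4m + 1 straddles the blocks m - 1 and m. One index is even and its
  half block contributes 8 modulo 16; the other contributes 0. So \<open>R\<close> has valuation
  exactly 3 there.\<close>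

lemma block_invariant_1_mod_4:
  assumes "m \<ge> 0"
    and IH: "\<And>k. k \<in> {m - 1, m} \<Longrightarrow> k \<ge> 0 \<Longrightarrow> odd k \<Longrightarrow> \<exists>e\<ge>3. block_invariant k e"
  shows "block_invariant (4 * m + 1) 3"
proof -
  define n where "n = 4 * m + 1"
  have "R n mod 16 = 8"
  proof -
    define A where "A = t5 (4 * m) + 5 * t5 (4 * m + 1)"
    define B where "B = 5 * t5 (4 * (m - 1) + 2) + t5 (4 * (m - 1) + 3)"
    have "R n = B - A"
      by (simp add: A_def B_def R_def n_def)
    moreover have "A mod 16 = 8 \<and> B mod 16 = 0 \<or> A mod 16 = 0 \<and> B mod 16 = 8"
    proof (cases "even m")
      case True
      have "B mod 16 = 0"
      proof (cases "m = 0")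
        case True
        \<comment> \<open>Block -1 lies entirely in the extension by zero.\<close>
        then show ?thesis by (simp add: B_def t5_def)
      next
        case False
        then obtain e where "e \<ge> 3" "block_invariant (m - 1) e"
          using IH[of "m - 1"] \<open>even m\<close> assms(1) by auto
        then show ?thesis
          unfolding B_def by (intro half_block_mod_16_odd(2))
      qed
      then show ?thesis
        using half_block_mod_16_even(1)[OF True assms(1)] by (simp add: A_def)
    next
      case False
      then obtain e where "e \<ge> 3" "block_invariant m e"
        using IH[of m] assms(1) by auto
      moreover have "m \<noteq> 0"
        using False by auto
      then have "B mod 16 = 8"
        unfolding B_def using False assms(1) by (intro half_block_mod_16_even(2)) auto
      ultimately show ?thesis
        using half_block_mod_16_odd(1) by (auto simp: A_def)
    qed
    ultimately show ?thesis
      using mod_diff_eq[of B 16 A] by auto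
  qed
  then obtain w where w: "R n = 16 * w + 8"
    by (metis mult_div_mod_eq)
  \<comment> \<open>This carries the divisibility of \<open>R n\<close> over to
    \<open>S n\<close>.\<close>
  moreover have "S n = 5 * R n - 24 * (t5 (n - 3) - t5 n)"
    by (simp add: R_def S_def)
  ultimately have "R n = 8 * (2 * w + 1)" "S n = 4 * (20 * w + 10 - 6 * (t5 (n - 3) - t5 n))"
    by simp_all
  moreover obtain p where "P n = 2 * p"
    using w parity_R_P[of n] by (auto elim: evenE)
  ultimately have "block_invariant n 3"
    unfolding block_invariant_def eigenforms
    by (intro exI[of _ p] exI[of _ "2 * Q n"] exI[of _ "2 * w + 1"]
        exI[of _ "20 * w + 10 - 6 * (t5 (n - 3) - t5 n)"]) simp
  then show ?thesis
    by (simp only: n_def)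
qed

section \<open>The valuation\<close>

definition t5_valuation :: "nat \<Rightarrow> nat" where
  "t5_valuation v = 4 * ((v + 1) div 2) - v mod 2"

text \<open>Matches \<open>block_invariant_step\<close>: replacing m by 4m + 3 multiplies m + 1 by
  4.\<close>

lemma t5_valuation_add_2: "t5_valuation (v + 2) = t5_valuation v + 4"
  by (cases "even v") (auto simp: t5_valuation_def elim!: evenE oddE)

lemma t5_valuation_ge_3: "v > 0 \<Longrightarrow> t5_valuation v \<ge> 3"
  by (cases "even v") (auto simp: t5_valuation_def elim!: evenE oddE)

lemma enat_t5_valuation:
  "nat (4 * \<lceil>real v / 2\<rceil> - int (v mod 2)) = t5_valuation v"
proof -
  have "\<lceil>real v / 2\<rceil> = int ((v + 1) div 2)"
    by (rule ceiling_unique; cases "even v") (auto elim!: evenE oddE)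
  then show ?thesis
    by (cases "even v") (auto simp: t5_valuation_def elim!: evenE oddE)
qed

text \<open>Strong induction: even n and n = 4m + 1 are the base congruences, with exponents 0 and
  3, the latter using blocks m - 1 and m; n = 4m + 3 is the eigenvalue step from m.\<close>

lemma block_invariant_t5_valuation:
  "block_invariant (int n) (t5_valuation (multiplicity 2 (n + 1)))"
proof (induction n rule: less_induct)
  case (less n)
  have "even n \<or> n = 4 * (n div 4) + 1 \<or> n = 4 * (n div 4) + 3"
    by presburger
  then consider "even n" | m where "n = 4 * m + 1" | m where "n = 4 * m + 3"
    by blast
  then show ?case
  proof cases
    case 1
    then have "multiplicity 2 (n + 1) = 0"
      by (intro not_dvd_imp_multiplicity_0) simp
    then show ?thesis
      using 1 block_invariant_even[of "int n"] by (simp add: t5_valuation_def)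
  next
    case 2
    have "multiplicity 2 (n + 1) = multiplicity 2 (2 * (2 * m + 1))"
      using 2 by (simp add: algebra_simps)
    also have "\<dots> = 1"
      by (subst multiplicity_times_same) (auto intro: not_dvd_imp_multiplicity_0)
    finally have v: "t5_valuation (multiplicity 2 (n + 1)) = 3"
      by (simp add: t5_valuation_def)
    \<comment> \<open>For odd k the number k + 1 has positive valuation, which forces an exponent of
      at least 3.\<close>
    have IH: "\<exists>e\<ge>3. block_invariant k e" if k: "k \<in> {int m - 1, int m}" "k \<ge> 0" "odd k" for k
    proof -
      obtain l where l: "k = int l"
        using k(2) nonneg_int_cases by blast
      then have "multiplicity 2 (l + 1) > 0"
        using k(3) by (subst multiplicity_gt_zero_iff) auto
      moreover have "l < n"
        using k(1) l 2 by auto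
      ultimately show ?thesis
        using less.IH[of l] t5_valuation_ge_3 l by blast
    qed
    show ?thesis
      using block_invariant_1_mod_4[of "int m", OF _ IH] 2 v by (simp add: add.commute)
  next
    case 3
    have "multiplicity 2 (n + 1) = multiplicity 2 (2 * (2 * (m + 1)))"
      using 3 by (intro arg_cong[of _ _ "multiplicity 2"]) simp
    also have "\<dots> = multiplicity 2 (m + 1) + 2"
      by (subst multiplicity_times_same; simp del: mult_Suc_right add_2_eq_Suc')+
    finally have "t5_valuation (multiplicity 2 (n + 1)) = t5_valuation (multiplicity 2 (m + 1)) + 4"
      by (simp only: t5_valuation_add_2)
    moreover have "int n = 4 * int m + 3" "m < n"
      using 3 by simp_all
    ultimately show ?thesis
      using block_invariant_step[OF less.IH[of m]] by simp
  qed
qed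

lemma nu2_power_mult_odd:
  assumes "odd y"
  shows "nu2 (2 ^ e * y) = enat e"
  using assms by (auto simp: nu2_def multiplicity_prime_elem_times_other not_dvd_imp_multiplicity_0
      prime_elem_multiplicity_mult_distrib)

theorem theorem2:
  shows "(\<forall>n::nat. \<forall>j\<in>{0, 1, 2, 3::nat}.
            nu2 (tm 5 (4 * n + j)) =
              (let v = multiplicity 2 (n + 1)
               in enat (nat (4 * \<lceil>real v / 2\<rceil> - int (v mod 2))))) \<and>
         (\<forall>n::nat. tm 5 n \<noteq> 0)"
proof -
  have val: "nu2 (tm 5 (4 * n + j)) = enat (t5_valuation (multiplicity 2 (n + 1)))"
    if "j \<in> {0, 1, 2, 3}" for n j
  proof -
    have "int j \<in> {0, 1, 2, 3}"
      using that by auto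
    then obtain y where "odd y"
      and "t5 (4 * int n + int j) = 2 ^ t5_valuation (multiplicity 2 (n + 1)) * y"
      using block_invariant_imp_odd_part[OF block_invariant_t5_valuation] by blast
    then have "tm 5 (4 * n + j) = 2 ^ t5_valuation (multiplicity 2 (n + 1)) * y"
      using t5_of_nat[of "4 * n + j"] by simp
    then show ?thesis
      by (simp only: nu2_power_mult_odd[OF \<open>odd y\<close>])
  qed
  have "tm 5 n \<noteq> 0" for n
  proof -
    have "n mod 4 \<in> {0, 1, 2, 3}"
      by auto
    \<comment> \<open>A finite valuation excludes 0, where \<open>nu2\<close> is infinite.\<close>
    from val[OF this, of "n div 4"] show ?thesis
      by (auto simp: nu2_def)
  qed
  with val show ?thesis
    by (simp only: Let_def enat_t5_valuation) blast
qed

end
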